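(* Let $(X,d)$ be a compact metric space with Borel $\sigma$-algebra $\mathcal{B}$, let $\varphi:X\multimap X$ be a lower semicontinuous multivalued map, and let $\mu\in\mathcal{M}_1(\varphi)$ be a $\varphi$-invariant Borel probability measure satisfying \[ \mu(\varphi_{+}^{-1}(A))=\mu(A)\quad\text{and}\quad \mu(\varphi_{+}^{-1}(A)\cap\varphi_{+}^{-1}(B)) = \mu(\varphi_{+}^{-1}(A\cap B)) \] for all $A,B\in\mathcal{B}$. Then \[ h_{\mu}(\varphi) \leq h_+(\varphi), \] where $h_\mu(\varphi)$ is the metric entropy and $h_+(\varphi)$ is the topological entropy of $\varphi$.
   Context: Multivalued maps. A multivalued map $\varphi:X\multimap Y$ assigns to each $x\in X$ a nonempty subset $\varphi(x)\subset Y$. For $B\subset Y$ the large preimage is $\varphi^{-1}_+(B):=\{x\in X:\varphi(x)\cap B\neq\emptyset\}$. The map $\varphi$ is lower semicontinuous (l.s.c.) if $\varphi^{-1}_+(B)$ is open for every open $B\subset Y$. For $\varphi:X\multimap X$, iterates are $\varphi^0(x)=\{x\}$, $\varphi^{k+1}(x)=\bigcup_{y\in\varphi^k(x)}\varphi(y)$, and $\varphi_+^{-k}(B)=\{x\in X:\varphi^k(x)\cap B\ne\emptyset\}$. Invariant measures. A Borel probability measure $\mu$ on $X$ is $\varphi$-invariant if $\mu(\varphi^{-1}_+(A))\ge\mu(A)$ for every $A\in\mathcal{B}$. $\mathcal{M}_1(\varphi)$ is the set of all $\varphi$-invariant measures. Metric entropy $h_\mu(\varphi)$. A measurable partition of $X$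 is a countable family of pairwise disjoint measurable sets whose union has full measure; its entropy is $H_\mu(\mathcal{P})=-\sum_{P\in\mathcal{P}}\mu(P)\log\mu(P)$ with $0\log 0=0$. For a totally ordered finite partition $\mathcal{P}=\{P_1,\dots,P_m\}$ put $\tilde{\mathcal{P}}_0=\mathcal{P}$ and, for $k\ge1$, let $\tilde{\mathcal{P}}_k$ be the family with elements $\tilde P_{1,k}=\varphi^{-k}_+(P_1)$ and $\tilde P_{j,k}=\varphi^{-k}_+(P_j)\setminus\bigcup_{i<j}\varphi^{-k}_+(P_i)$, $j=2,\dots,m$. Let $\mathcal{P}'_n=\bigvee_{k=0}^{n-1}\tilde{\mathcal{P}}_k$ be the family of all nonempty sets $Q_0\cap\dots\cap Q_{n-1}$ with $Q_k\in\tilde{\mathcal{P}}_k$. Set $h_\mu(\varphi,\mathcal{P})=\limsup_{n\to\infty}\frac1n H_\mu(\mathcal{P}'_n)$ and $h_\mu(\varphi)=\sup_{\mathcal{P}}h_\mu(\varphi,\mathcal{P})$, the supremum being over all finite totally ordered partitions of $X$. Topological entropy $h_+(\varphi)$ (for l.s.c. $\varphi:X\multimap X$, $X$ compact metric). For an open cover $\mathcal{A}$ of $X$ let $\mathcal{A}^n_{\varphi_+}=\bigvee_{j=0}^{n-1}\varphi_+^{-j}(\mathcal{A})$ be the open cover consisting of all nonempty sets $\bigcap_{j=0}^{n-1}\varphi_+^{-j}(A_j)$ with $A_j\in\mathcal{A}$, and let $\mathrm{N}(\mathcal{A}^n_{\varphi_+})$ be the minimal cardinality of a subcover of it. Set $h_+(\varphi,\mathcal{A})=\lim_{n\to\infty}\frac1n\log\mathrm{N}(\mathcal{A}^n_{\varphi_+})$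 (the limit exists) and $h_+(\varphi)=\sup\{h_+(\varphi,\mathcal{A}):\mathcal{A}\text{ an open cover of }X\}$. *)

theory Defs
  imports "HOL-Probability.Probability"
begin

text \<open>
  The space $X$ is a type of class \<open>metric_space\<close> (compactness is a hypothesis of the theorem);
  a multivalued map $X \multimap X$ is a set-valued function satisfying \<open>multivalued\<close>.
\<close>

definition multivalued :: "('a \<Rightarrow> 'b set) \<Rightarrow> bool" where
  "multivalued \<phi> \<longleftrightarrow> (\<forall>x. \<phi> x \<noteq> {})"

definition large_preimage :: "('a \<Rightarrow> 'b set) \<Rightarrow> 'b set \<Rightarrow> 'a set" where
  "large_preimage \<phi> B = {x. \<phi> x \<inter> B \<noteq> {}}"

definition lsc :: "('a::topological_space \<Rightarrow> 'b::topological_space set) \<Rightarrow> bool" where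
  "lsc \<phi> \<longleftrightarrow> (\<forall>B. open B \<longrightarrow> open (large_preimage \<phi> B))"

primrec miter :: "('a \<Rightarrow> 'a set) \<Rightarrow> nat \<Rightarrow> 'a \<Rightarrow> 'a set" where
  "miter \<phi> 0 x = {x}"
| "miter \<phi> (Suc k) x = (\<Union>y\<in>miter \<phi> k x. \<phi> y)"

text \<open>
  The large preimage of a Borel set under a lower semicontinuous map need not be Borel (for maps
  with Borel graph it is only analytic), so writing $\mu(\varphi_+^{-1}(A))$ presupposes that this
  set is measurable.  We only ask for $\mu$-measurability, i.e. membership in the completed
  $\sigma$-algebra, and evaluate $\mu$ on such sets through its completion.  If the large preimages
  are Borel, \<open>measure (completion \<mu>)\<close> is just \<open>measure \<mu>\<close> on them.
\<close>

definition invariant_measures :: "('a::topological_space \<Rightarrow> 'a set) \<Rightarrow> 'a measure set" where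
  "invariant_measures \<phi> = {\<mu>. prob_space \<mu> \<and> sets \<mu> = sets borel \<and>
     (\<forall>A\<in>sets borel. large_preimage \<phi> A \<in> sets (completion \<mu>) \<and>
        measure (completion \<mu>) (large_preimage \<phi> A) \<ge> measure \<mu> A)}"

definition join :: "nat \<Rightarrow> (nat \<Rightarrow> 'a set set) \<Rightarrow> 'a set set" where
  "join n F = {W. W \<noteq> {} \<and> (\<exists>Q. (\<forall>k<n. Q k \<in> F k) \<and> W = (\<Inter>k<n. Q k))}"

text \<open>
  A finite totally ordered partition is the list of its members in increasing order; hence the
  list is required to be distinct.
\<close>

definition ordered_partition :: "'a measure \<Rightarrow> 'a set list \<Rightarrow> bool" where
  "ordered_partition \<mu> Ps \<longleftrightarrow> distinct Ps \<and> disjoint (set Ps) \<and> set Ps \<subseteq> sets \<mu> \<and>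
     measure \<mu> (\<Union>(set Ps)) = measure \<mu> (space \<mu>)"

text \<open>Used for finite families only.  The convention $0 \log 0 = 0$ is automatic.\<close>

definition partition_entropy :: "'a measure \<Rightarrow> 'a set set \<Rightarrow> real" where
  "partition_entropy \<mu> \<P> =
     - (\<Sum>P\<in>\<P>. measure (completion \<mu>) P * ln (measure (completion \<mu>) P))"

definition pulled_partition :: "('a \<Rightarrow> 'a set) \<Rightarrow> 'a set list \<Rightarrow> nat \<Rightarrow> 'a set set" where
  "pulled_partition \<phi> Ps k =
     (if k = 0 then set Ps
      else {large_preimage (miter \<phi> k) (Ps ! j) - (\<Union>i<j. large_preimage (miter \<phi> k) (Ps ! i))
            | j. j < length Ps})"

definition metric_entropy_of ::
    "'a measure \<Rightarrow> ('a \<Rightarrow> 'a set) \<Rightarrow> 'a set list \<Rightarrow> ereal" where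
  "metric_entropy_of \<mu> \<phi> Ps =
     limsup (\<lambda>n. ereal (partition_entropy \<mu> (join n (pulled_partition \<phi> Ps)) / real n))"

definition metric_entropy :: "'a measure \<Rightarrow> ('a \<Rightarrow> 'a set) \<Rightarrow> ereal" where
  "metric_entropy \<mu> \<phi> = (SUP Ps\<in>{Ps. ordered_partition \<mu> Ps}. metric_entropy_of \<mu> \<phi> Ps)"

definition open_cover :: "'a::topological_space set set \<Rightarrow> bool" where
  "open_cover \<A> \<longleftrightarrow> (\<forall>A\<in>\<A>. open A) \<and> \<Union>\<A> = UNIV"

definition pulled_cover :: "('a \<Rightarrow> 'a set) \<Rightarrow> 'a set set \<Rightarrow> nat \<Rightarrow> 'a set set" where
  "pulled_cover \<phi> \<A> j = large_preimage (miter \<phi> j) ` \<A>"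

text \<open>On a compact space finite subcovers exist, so the infimum in \<open>nat\<close> is a minimum.\<close>

definition min_subcover :: "'a set set \<Rightarrow> nat" where
  "min_subcover \<C> = Inf {card \<D> | \<D>. \<D> \<subseteq> \<C> \<and> finite \<D> \<and> \<Union>\<D> = UNIV}"

definition topological_entropy_of :: "('a \<Rightarrow> 'a set) \<Rightarrow> 'a set set \<Rightarrow> ereal" where
  "topological_entropy_of \<phi> \<A> =
     lim (\<lambda>n. ereal (ln (real (min_subcover (join n (pulled_cover \<phi> \<A>)))) / real n))"

definition topological_entropy :: "('a::topological_space \<Rightarrow> 'a set) \<Rightarrow> ereal" where
  "topological_entropy \<phi> = (SUP \<A>\<in>{\<A>. open_cover \<A>}. topological_entropy_of \<phi> \<A>)"

end

theory Submission
  imports Defs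
begin

text \<open>
  Under the two hypotheses on $\mu$, the large preimage acts on the measure algebra as a
  measure-preserving Boolean homomorphism, so up to null sets itineraries behave as for a
  single-valued map.  Given an ordered partition $P_1, \dots, P_r$, choose closed
  $C_i \subseteq P_i$ of almost full measure and the open cover by
  $U_i = X \setminus \bigcup_{l \neq i} C_l$.  An element $\bigcap_k \varphi_+^{-k}(U_{i_k})$ of a
  minimal subcover predicts the itinerary of its points: at time $k$ it is $i_k$, except at points
  of the bad set $\varphi_+^{-k}(\bigcup_i P_i \setminus C_i)$.  Gibbs' inequality is applied to the
  probability vector $q$ on words which averages, over the subcover, the product measures with
  weights $w(a, i) = (1 - \varepsilon) [a = i] + \varepsilon / r$.  It bounds the entropy of
  the joined partition by $\log \mathrm{N}$ plus $n$ times an arbitrarily small number, with no need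
  to pass to powers of $\varphi$.
\<close>

section \<open>Large preimages and their iterates\<close>

lemma large_preimage_mono: "A \<subseteq> B \<Longrightarrow> large_preimage \<psi> A \<subseteq> large_preimage \<psi> B"
  by (auto simp: large_preimage_def)

lemma large_preimage_UN: "large_preimage \<psi> (\<Union>i\<in>I. A i) = (\<Union>i\<in>I. large_preimage \<psi> (A i))"
  by (auto simp: large_preimage_def)

lemma large_preimage_miter_0 [simp]: "large_preimage (miter \<phi> 0) B = B"
  by (auto simp: large_preimage_def)

text \<open>\<open>miter\<close> appends the new step at the far end, so the one-step preimage is
  taken first, on the inside. Inductions on k therefore have to leave the target set
  arbitrary.\<close>

lemma large_preimage_miter_Suc:
  "large_preimage (miter \<phi> (Suc k)) B = large_preimage (miter \<phi> k) (large_preimage \<phi> B)"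
  by (auto simp: large_preimage_def)

declare miter.simps [simp del]

lemma large_preimage_miter_add:
  "large_preimage (miter \<phi> (j + k)) B = large_preimage (miter \<phi> j) (large_preimage (miter \<phi> k) B)"
  by (induction k arbitrary: B) (simp_all add: large_preimage_miter_Suc)

lemma large_preimage_miter_UNIV:
  assumes "multivalued \<phi>"
  shows "large_preimage (miter \<phi> k) UNIV = UNIV"
proof (induction k)
  case (Suc k)
  have "large_preimage \<phi> UNIV = UNIV"
    using assms by (auto simp: large_preimage_def multivalued_def)
  then show ?case
    using Suc by (simp add: large_preimage_miter_Suc)
qed simp

lemma open_large_preimage_miter:
  assumes "lsc \<phi>" "open B"
  shows "open (large_preimage (miter \<phi> k) B)"
  using assms(2)
proof (induction k arbitrary: B)
  case (Suc k)
  then show ?case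
    using assms(1) by (simp add: large_preimage_miter_Suc lsc_def)
qed simp

text \<open>At time 0 the members are disjoint, so removing the earlier ones changes nothing. The
  separate clause for k = 0 thus agrees with the general formula, and later arguments can treat all
  times alike.\<close>

lemma pulled_partition_eq:
  assumes "distinct Ps" "disjoint (set Ps)"
  shows "pulled_partition \<phi> Ps k =
    (\<lambda>j. large_preimage (miter \<phi> k) (Ps ! j) - (\<Union>i<j. large_preimage (miter \<phi> k) (Ps ! i))) ` {..<length Ps}"
proof (cases "k = 0")
  case True
  have "Ps ! j - (\<Union>i<j. Ps ! i) = Ps ! j" if "j < length Ps" for j
  proof -
    have "Ps ! i \<inter> Ps ! j = {}" if "i < j" for i
      using assms that \<open>j < length Ps\<close>
      by (intro disjointD[of "set Ps"]) (auto simp: nth_eq_iff_index_eq)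
    then show ?thesis by blast
  qed
  then have "(\<lambda>j. Ps ! j - (\<Union>i<j. Ps ! i)) ` {..<length Ps} = (!) Ps ` {..<length Ps}"
    by (intro image_cong) auto
  also have "\<dots> = set Ps"
    by (auto simp: in_set_conv_nth)
  finally show ?thesis
    using True by (simp add: pulled_partition_def)
qed (auto simp: pulled_partition_def)

section \<open>Minimal subcovers\<close>

lemma min_subcover_le:
  assumes "\<D> \<subseteq> \<C>" "finite \<D>" "\<Union>\<D> = UNIV"
  shows "min_subcover \<C> \<le> card \<D>"
  unfolding min_subcover_def using assms by (intro cInf_lower) auto

lemma min_subcover_attained:
  assumes "\<D> \<subseteq> \<C>" "finite \<D>" "\<Union>\<D> = UNIV"
  obtains \<D>' where "\<D>' \<subseteq> \<C>" "finite \<D>'" "\<Union>\<D>' = UNIV" "card \<D>' = min_subcover \<C>"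
proof -
  have "min_subcover \<C> \<in> {card \<D> | \<D>. \<D> \<subseteq> \<C> \<and> finite \<D> \<and> \<Union>\<D> = UNIV}"
    unfolding min_subcover_def using assms by (intro Inf_nat_def1) auto
  then show ?thesis using that by auto
qed

section \<open>Subadditive sequences and Gibbs' inequality\<close>

text \<open>Fekete's lemma, with the infimum of the quotients as limit. Nonnegativity keeps this
  infimum finite.\<close>

lemma convergent_subadditive:
  fixes a :: "nat \<Rightarrow> real"
  assumes nonneg: "\<And>n. 0 \<le> a n" and sub: "\<And>m n. a (m + n) \<le> a m + a n"
  shows "convergent (\<lambda>n. a n / real n)"
proof -
  \<comment> \<open>The infimum starts at 1 because \<open>a 0 / real 0\<close> has the default
    value 0 and would force \<open>L = 0\<close>.\<close>
  define L where "L = (INF n\<in>{1..}. a n / real n)"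
  have bdd: "bdd_below ((\<lambda>n. a n / real n) ` {1..})"
    by (rule bdd_belowI2[where m = 0]) (use nonneg in auto)
  have mult: "a (q * m + s) \<le> real q * a m + a s" for q m s
  proof (induction q)
    case (Suc q)
    have "a (Suc q * m + s) \<le> a m + a (q * m + s)"
      using sub[of m "q * m + s"] by (simp add: ac_simps)
    with Suc show ?case by (simp add: algebra_simps)
  qed simp
  have "(\<lambda>n. a n / real n) \<longlonglongrightarrow> L"
  proof (rule LIMSEQ_I)
    fix e :: real assume "e > 0"
    then have "\<exists>m\<in>{1..}. a m / real m < L + e / 2"
      using cINF_less_iff[of "{1::nat..}" "\<lambda>n. a n / real n", OF _ bdd, of "L + e / 2"] by (auto simp: L_def)
    then obtain m where m: "m \<ge> 1" "a m / real m < L + e / 2" by auto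
    \<comment> \<open>Writing n as a multiple of m plus \<open>n mod m\<close>, the remainder
      contributes at most \<open>K\<close>, whatever n is; \<open>n0\<close> makes
      \<open>K / real n\<close> smaller than \<open>e / 2\<close>.\<close>
    define K where "K = Max (a ` {..<m})"
    obtain n0 :: nat where n0: "real n0 > 2 * K / e" using reals_Archimedean2 by blast
    show "\<exists>no. \<forall>n\<ge>no. norm (a n / real n - L) < e"
    proof (intro exI allI impI)
      fix n assume n: "n \<ge> max 1 n0"
      have "L \<le> a n / real n"
        unfolding L_def using n by (intro cINF_lower bdd) auto
      moreover have "a n / real n < L + e"
      proof -
        have "real (n div m * m) \<le> real n"
          by (simp only: of_nat_le_iff div_times_less_eq_dividend)
        then have div_le: "real (n div m) \<le> real n / real m"
          using m by (simp add: field_simps)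
        have "a n \<le> real (n div m) * a m + a (n mod m)"
          using mult[of "n div m" m "n mod m"] by simp
        also have "a (n mod m) \<le> K"
          unfolding K_def using m by (intro Max_ge) auto
        also have "real (n div m) * a m \<le> real n / real m * a m"
          using nonneg div_le by (intro mult_right_mono) auto
        finally have "a n \<le> real n * (a m / real m) + K" by (simp add: field_simps)
        then have "a n / real n \<le> a m / real m + K / real n"
          using n by (simp add: field_simps)
        also have "K / real n < e / 2"
        proof -
          have "2 * K / e < real n" using n n0 by linarith
          then show ?thesis using n \<open>e > 0\<close> by (simp add: field_simps)
        qed
        finally show ?thesis using m by simp
      qed
      ultimately show "norm (a n / real n - L) < e" by simp
    qed
  qed
  then show ?thesis by (rule convergentI)
qed

text \<open>Sum the bound \<open>ln t \<le> t - 1\<close> at \<open>t = q i / p i\<close>, weighted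
  by \<open>p i\<close>. Comparing the sums, rather than normalising both, lets q be the restriction
  of a probability vector to the words that really occur.\<close>

lemma gibbs_inequality:
  fixes p q :: "'b \<Rightarrow> real"
  assumes "\<And>i. i \<in> I \<Longrightarrow> 0 \<le> p i" "\<And>i. i \<in> I \<Longrightarrow> 0 < q i" "sum q I \<le> sum p I"
  shows "- (\<Sum>i\<in>I. p i * ln (p i)) \<le> - (\<Sum>i\<in>I. p i * ln (q i))"
proof -
  have "p i * ln (q i) - p i * ln (p i) \<le> q i - p i" if "i \<in> I" for i
  proof (cases "p i = 0")
    case False
    then have "p i > 0" "q i > 0" using assms(1,2) that by (auto simp: less_le)
    then have "ln (q i) - ln (p i) \<le> q i / p i - 1"
      using ln_le_minus_one[of "q i / p i"] by (simp add: ln_div)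
    then have "p i * (ln (q i) - ln (p i)) \<le> p i * (q i / p i - 1)"
      using \<open>p i > 0\<close> by (intro mult_left_mono) auto
    also have "p i * (q i / p i - 1) = q i - p i" using \<open>p i > 0\<close> by (simp add: field_simps)
    finally show ?thesis by (simp add: right_diff_distrib)
  qed (use assms(2) that in \<open>auto intro: less_imp_le\<close>)
  then have "(\<Sum>i\<in>I. p i * ln (q i) - p i * ln (p i)) \<le> (\<Sum>i\<in>I. q i - p i)"
    by (rule sum_mono)
  with assms(3) show ?thesis by (simp add: sum_subtractf)
qed

section \<open>Regularity of finite Borel measures on metric spaces\<close>

text \<open>Approximating from inside and outside at once makes the property stable under
  complements, where F and U swap roles, so that induction over the generated \<sigma>-algebra
  works.\<close>

lemma closed_open_approximation:
  fixes A :: "'a::metric_space set"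
  assumes "finite_measure M" and sets_M: "sets M = sets borel" and A: "A \<in> sets borel" and "0 < e"
  shows "\<exists>F U. closed F \<and> open U \<and> F \<subseteq> A \<and> A \<subseteq> U \<and> measure M (U - F) < e"
proof -
  interpret finite_measure M by fact
  have borel_M: "B \<in> sets M" if "B \<in> sets borel" for B
    using that sets_M by simp
  have "A \<in> sigma_sets UNIV (Collect open)"
    using A by (simp add: borel_def)
  then show ?thesis
    using \<open>0 < e\<close>
  proof (induction A arbitrary: e)
    case (Basic U)
    \<comment> \<open>The points at distance at least 1/(n+1) from the complement of U: closed sets
      increasing to U. The outer open set is U itself.\<close>
    define F where "F n = (\<Inter>y\<in>-U. {x. 1 / real (Suc n) \<le> dist x y})" for n
    have closed_F: "closed (F n)" for n
      unfolding F_def by (intro closed_INT ballI closed_Collect_le continuous_intros)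
    have "incseq F"
    proof (intro monoI)
      fix m n :: nat assume "m \<le> n"
      then have "1 / real (Suc n) \<le> 1 / real (Suc m)" by (simp add: field_simps)
      then show "F m \<subseteq> F n" unfolding F_def by (auto intro: order_trans)
    qed
    have "(\<Union>n. F n) = U"
    proof (intro equalityI subsetI)
      fix x assume "x \<in> U"
      then obtain d where d: "d > 0" "ball x d \<subseteq> U"
        using Basic by (auto simp: open_contains_ball)
      then obtain n where "1 / real (Suc n) < d" using nat_approx_posE by blast
      with d have "x \<in> F n" unfolding F_def by (force simp: subset_iff)
      then show "x \<in> (\<Union>n. F n)" by blast
    next
      fix x assume "x \<in> (\<Union>n. F n)"
      then obtain n where "x \<in> F n" by blast
      then show "x \<in> U"
        unfolding F_def by (cases "x \<in> U") (auto dest!: bspec[of _ _ x])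
    qed
    moreover have "(\<lambda>n. measure M (F n)) \<longlonglongrightarrow> measure M (\<Union>n. F n)"
      using closed_F \<open>incseq F\<close> by (intro finite_Lim_measure_incseq) (auto intro!: borel_M)
    ultimately have "(\<lambda>n. measure M (F n)) \<longlonglongrightarrow> measure M U" by simp
    from order_tendstoD(1)[OF this, of "measure M U - e"] Basic obtain n
      where n: "measure M U - e < measure M (F n)"
      by (auto dest: eventually_happens)
    have "F n \<subseteq> U" using \<open>(\<Union>n. F n) = U\<close> by blast
    moreover have "measure M (U - F n) < e"
      using n Basic closed_F[of n] \<open>F n \<subseteq> U\<close> by (subst finite_measure_Diff) (auto intro!: borel_M)
    ultimately show ?case using Basic closed_F[of n] by blast
  next
    case Empty
    then show ?case by (intro exI[of _ "{}"]) auto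
  next
    case (Compl A)
    then obtain F U where "closed F" "open U" "F \<subseteq> A" "A \<subseteq> U" "measure M (U - F) < e"
      by meson
    moreover have "(UNIV - F) - (UNIV - U) = U - F" by blast
    ultimately show ?case
      by (intro exI[of _ "UNIV - U"] exI[of _ "UNIV - F"]) (auto simp: closed_Compl open_Compl Compl_eq_Diff_UNIV[symmetric] simp del: Compl_iff)
  next
    case (Union A)
    \<comment> \<open>The errors form a geometric series of total \<open>e / 2\<close>; the other
      half of e is reserved for making the inner set closed.\<close>
    have "\<exists>F U. closed F \<and> open U \<and> F \<subseteq> A i \<and> A i \<subseteq> U \<and> measure M (U - F) < e / 2 * (1 / 2) ^ Suc i" for i
      by (rule Union.IH) (use Union.prems in simp)
    then obtain F U where FU: "closed (F i)" "open (U i)" "F i \<subseteq> A i" "A i \<subseteq> U i"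
      "measure M (U i - F i) < e / 2 * (1 / 2) ^ Suc i" for i by metis
    have meas: "F i \<in> sets M" "U i \<in> sets M" for i
      using FU(1,2)[of i] by (auto intro!: borel_M)
    have sums: "(\<lambda>i. e / 2 * (1 / 2) ^ Suc i) sums (e / 2 * 1)"
      by (intro sums_mult power_half_series)
    have summable: "summable (\<lambda>i. measure M (U i - F i))"
      by (rule summable_comparison_test'[OF sums_summable[OF sums], of 0])
        (use FU(5) in \<open>auto intro: less_imp_le\<close>)
    have "measure M ((\<Union>i. U i) - (\<Union>i. F i)) \<le> measure M (\<Union>i. U i - F i)"
      using meas by (intro finite_measure_mono) auto
    also have "\<dots> \<le> (\<Sum>i. measure M (U i - F i))"
      using meas summable by (intro finite_measure_subadditive_countably) auto
    also have "\<dots> \<le> (\<Sum>i. e / 2 * (1 / 2) ^ Suc i)"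
      using FU(5) summable sums_summable[OF sums] by (intro suminf_le) (auto intro: less_imp_le)
    also have "\<dots> = e / 2" using sums_unique[OF sums] by simp
    finally have tail: "measure M ((\<Union>i. U i) - (\<Union>i. F i)) \<le> e / 2" .
    \<comment> \<open>A countable union of closed sets need not be closed, so it is cut to a finite
      union; by continuity from below the lost mass is under \<open>e / 2\<close>.\<close>
    define G where "G n = (\<Union>i<n. F i)" for n
    have G_meas: "G n \<in> sets M" for n unfolding G_def using meas by auto
    have "incseq G" unfolding G_def by (intro monoI UN_mono) auto
    then have "(\<lambda>n. measure M (G n)) \<longlonglongrightarrow> measure M (\<Union>n. G n)"
      using G_meas by (intro finite_Lim_measure_incseq) auto
    moreover have G_Un: "(\<Union>n. G n) = (\<Union>i. F i)" unfolding G_def by blast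
    ultimately have "(\<lambda>n. measure M (G n)) \<longlonglongrightarrow> measure M (\<Union>i. F i)" by simp
    from order_tendstoD(1)[OF this, of "measure M (\<Union>i. F i) - e / 2"] Union.prems obtain n
      where n: "measure M (\<Union>i. F i) - e / 2 < measure M (G n)"
      by (auto dest: eventually_happens)
    have "G n \<subseteq> (\<Union>i. F i)" using G_Un by blast
    then have "measure M ((\<Union>i. F i) - G n) < e / 2"
      using n meas G_meas by (subst finite_measure_Diff) auto
    moreover have "measure M ((\<Union>i. U i) - G n)
        \<le> measure M (((\<Union>i. U i) - (\<Union>i. F i)) \<union> ((\<Union>i. F i) - G n))"
      using meas G_meas by (intro finite_measure_mono) auto
    moreover have "\<dots> \<le> measure M ((\<Union>i. U i) - (\<Union>i. F i)) + measure M ((\<Union>i. F i) - G n)"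
      using meas G_meas by (intro measure_Un_le) auto
    ultimately have "measure M ((\<Union>i. U i) - G n) < e" using tail by linarith
    moreover have "closed (G n)" unfolding G_def using FU(1) by auto
    moreover have "open (\<Union>i. U i)" using FU(2) by auto
    moreover have "G n \<subseteq> (\<Union>i. A i)"
      unfolding G_def using FU(3) by (intro UN_mono) auto
    moreover have "(\<Union>i. A i) \<subseteq> (\<Union>i. U i)"
      using FU(4) by (rule UN_mono[OF subset_refl])
    ultimately show ?case by blast
  qed
qed

section \<open>Measure-preserving multivalued maps on the completion\<close>

text \<open>The assumptions concern Borel sets, but preimages are only known to lie in the
  completion. Iterating therefore requires extending measurability and both equations to all sets of
  \<open>\<nu>\<close>, which is done below by squeezing between Borel sets.\<close>

locale measure_preserving_multimap = prob_space \<mu> for \<mu> :: "'a::metric_space measure" +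
  fixes \<phi> :: "'a \<Rightarrow> 'a set"
  assumes sets_eq_borel: "sets \<mu> = sets borel"
    and borel_preimage: "\<And>A. A \<in> sets borel \<Longrightarrow> large_preimage \<phi> A \<in> sets (completion \<mu>)"
    and borel_preserving: "\<And>A. A \<in> sets borel \<Longrightarrow>
      measure (completion \<mu>) (large_preimage \<phi> A) = measure \<mu> A"
    and borel_Int: "\<And>A B. A \<in> sets borel \<Longrightarrow> B \<in> sets borel \<Longrightarrow>
      measure (completion \<mu>) (large_preimage \<phi> A \<inter> large_preimage \<phi> B) =
      measure (completion \<mu>) (large_preimage \<phi> (A \<inter> B))"
begin

abbreviation \<nu> where "\<nu> \<equiv> completion \<mu>"

sublocale compl: prob_space \<nu>
  by (rule prob_space_completion)

lemma space_eq [simp]: "space \<mu> = UNIV"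
  using sets_eq_imp_space_eq[OF sets_eq_borel] by simp

lemma borel_sandwich:
  assumes "A \<in> sets \<nu>"
  obtains L U where "L \<in> sets borel" "U \<in> sets borel" "L \<subseteq> A" "A \<subseteq> U" "U - L \<in> null_sets \<mu>"
proof -
  obtain S N N' where "A = S \<union> N" "N \<subseteq> N'" "N' \<in> null_sets \<mu>" "S \<in> sets \<mu>"
    using assms unfolding sets_completion by (rule completionE)
  then show thesis
    using sets_eq_borel by (intro that[of S "S \<union> N'"] null_sets_subset[of N' \<mu> "S \<union> N' - S"]) auto
qed

text \<open>Preimages of the enclosing Borel sets L and U have equal measure, so the preimage of A
  is caught between two sets that differ by a null set, and completeness of \<open>\<nu>\<close>
  makes it measurable.\<close>

lemma sets_preimage:
  assumes A: "A \<in> sets \<nu>"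
  shows "large_preimage \<phi> A \<in> sets \<nu>"
proof -
  obtain L U where LU: "L \<in> sets borel" "U \<in> sets borel" "L \<subseteq> A" "A \<subseteq> U" "U - L \<in> null_sets \<mu>"
    using borel_sandwich[OF A] .
  then have "measure \<mu> U = measure \<mu> L"
    using finite_measure_Diff[of U L] sets_eq_borel by (auto simp: null_sets_def measure_def)
  then have "measure \<nu> (large_preimage \<phi> L) = measure \<nu> (large_preimage \<phi> U)"
    using LU(1,2) by (simp add: borel_preserving)
  then have "emeasure \<nu> (large_preimage \<phi> L) = emeasure \<nu> (large_preimage \<phi> U)"
    by (simp only: compl.emeasure_eq_measure)
  then show ?thesis
    by (rule completion.complete_sets_sandwich[OF borel_preimage[OF LU(1)] borel_preimage[OF LU(2)]
          large_preimage_mono[OF LU(3)] large_preimage_mono[OF LU(4)]])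
      (simp add: compl.emeasure_eq_measure)
qed

text \<open>Both sides lie between the measures of \<open>L \<inter> L'\<close> and
  \<open>U \<inter> U'\<close>, which coincide.\<close>

lemma measure_preimage_Int:
  assumes A: "A \<in> sets \<nu>" and B: "B \<in> sets \<nu>"
  shows "measure \<nu> (large_preimage \<phi> A \<inter> large_preimage \<phi> B) = measure \<nu> (A \<inter> B)"
proof -
  obtain L U where LU: "L \<in> sets borel" "U \<in> sets borel" "L \<subseteq> A" "A \<subseteq> U" "U - L \<in> null_sets \<mu>"
    using borel_sandwich[OF A] .
  obtain L' U' where LU': "L' \<in> sets borel" "U' \<in> sets borel" "L' \<subseteq> B" "B \<subseteq> U'" "U' - L' \<in> null_sets \<mu>"
    using borel_sandwich[OF B] .
  have in_\<mu>: "C \<in> sets \<mu>" if "C \<in> sets borel" for C using that sets_eq_borel by simp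
  have Int: "measure \<nu> (large_preimage \<phi> C \<inter> large_preimage \<phi> D) = measure \<mu> (C \<inter> D)"
    if "C \<in> sets borel" "D \<in> sets borel" for C D
    using that by (simp add: borel_Int borel_preserving)
  have "(U \<inter> U') - (L \<inter> L') \<in> null_sets \<mu>"
    by (rule null_sets_subset[of "(U - L) \<union> (U' - L')"]) (use LU LU' sets_eq_borel in auto)
  then have eq: "measure \<mu> (U \<inter> U') = measure \<mu> (L \<inter> L')"
    using finite_measure_Diff[of "U \<inter> U'" "L \<inter> L'"] LU LU' sets_eq_borel
    by (auto simp: null_sets_def measure_def)
  have "measure \<mu> (L \<inter> L') \<le> measure \<nu> (large_preimage \<phi> A \<inter> large_preimage \<phi> B)"
    unfolding Int[OF LU(1) LU'(1), symmetric]
    using LU LU' A B sets_preimage large_preimage_mono[of L A \<phi>] large_preimage_mono[of L' B \<phi>]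
    by (intro compl.finite_measure_mono) auto
  moreover have "measure \<nu> (large_preimage \<phi> A \<inter> large_preimage \<phi> B) \<le> measure \<mu> (U \<inter> U')"
    unfolding Int[OF LU(2) LU'(2), symmetric]
    using LU LU' A B sets_preimage borel_preimage large_preimage_mono[of A U \<phi>] large_preimage_mono[of B U' \<phi>]
    by (intro compl.finite_measure_mono) auto
  moreover have "measure \<mu> (L \<inter> L') \<le> measure \<nu> (A \<inter> B)"
    unfolding measure_completion[of "L \<inter> L'" \<mu>, OF in_\<mu>, OF sets.Int[OF LU(1) LU'(1)], symmetric]
    using LU LU' A B by (intro compl.finite_measure_mono) auto
  moreover have "measure \<nu> (A \<inter> B) \<le> measure \<mu> (U \<inter> U')"
    unfolding measure_completion[of "U \<inter> U'" \<mu>, OF in_\<mu>, OF sets.Int[OF LU(2) LU'(2)], symmetric]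
    using LU LU' A B in_\<mu> by (intro compl.finite_measure_mono) auto
  ultimately show "measure \<nu> (large_preimage \<phi> A \<inter> large_preimage \<phi> B) = measure \<nu> (A \<inter> B)"
    using eq by linarith
qed

lemma sets_preimage_miter: "A \<in> sets \<nu> \<Longrightarrow> large_preimage (miter \<phi> k) A \<in> sets \<nu>"
  by (induction k arbitrary: A) (auto simp: large_preimage_miter_Suc sets_preimage)

text \<open>The single-valued feature needed later: for disjoint A and B the iterated preimages
  overlap only in a null set.\<close>

lemma measure_preimage_miter_Int:
  "A \<in> sets \<nu> \<Longrightarrow> B \<in> sets \<nu> \<Longrightarrow>
    measure \<nu> (large_preimage (miter \<phi> k) A \<inter> large_preimage (miter \<phi> k) B) = measure \<nu> (A \<inter> B)"
  by (induction k arbitrary: A B) (auto simp: large_preimage_miter_Suc sets_preimage measure_preimage_Int)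

lemma measure_preimage_miter:
  "A \<in> sets \<nu> \<Longrightarrow> measure \<nu> (large_preimage (miter \<phi> k) A) = measure \<nu> A"
  using measure_preimage_miter_Int[of A A k] by simp

end

section \<open>Joined covers and existence of the topological entropy limit\<close>

lemma open_cover_join:
  assumes "\<And>k. k < n \<Longrightarrow> open_cover (F k)"
  shows "open_cover (join n F)"
  unfolding open_cover_def
proof (intro conjI ballI equalityI subset_UNIV subsetI)
  fix W assume "W \<in> join n F"
  then show "open W"
    using assms unfolding join_def open_cover_def by (auto intro!: open_INT)
next
  fix x :: 'a
  have "\<exists>A. A \<in> F k \<and> x \<in> A" if "k < n" for k
    using assms[OF that] UNIV_I[of x] unfolding open_cover_def by blast
  then obtain Q where "\<And>k. k < n \<Longrightarrow> Q k \<in> F k \<and> x \<in> Q k" by metis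
  then show "x \<in> \<Union>(join n F)"
    unfolding join_def by (intro UnionI[of "\<Inter>k<n. Q k"]) auto
qed

lemma open_cover_pulled_cover:
  assumes "multivalued \<phi>" "lsc \<phi>" "open_cover \<A>"
  shows "open_cover (pulled_cover \<phi> \<A> k)"
proof -
  have "\<Union>(pulled_cover \<phi> \<A> k) = large_preimage (miter \<phi> k) (\<Union>\<A>)"
    using large_preimage_UN[of "miter \<phi> k" "\<lambda>A. A" \<A>] by (simp add: pulled_cover_def)
  then show ?thesis
    using assms by (auto simp: open_cover_def pulled_cover_def open_large_preimage_miter
        large_preimage_miter_UNIV)
qed

context
  fixes \<phi> :: "'a::topological_space \<Rightarrow> 'a set" and \<A> :: "'a set set"
  assumes compact: "compact (UNIV :: 'a set)" and multivalued: "multivalued \<phi>"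
    and lsc: "lsc \<phi>" and cover: "open_cover \<A>"
begin

text \<open>Compactness yields a finite subcover, so the set of cardinalities in
  \<open>min_subcover\<close> is nonempty and its infimum is attained.\<close>

lemma join_subcover:
  obtains \<D> where "\<D> \<subseteq> join n (pulled_cover \<phi> \<A>)" "finite \<D>" "\<Union>\<D> = UNIV"
    "card \<D> = min_subcover (join n (pulled_cover \<phi> \<A>))"
proof -
  have "open_cover (join n (pulled_cover \<phi> \<A>))"
    by (intro open_cover_join open_cover_pulled_cover multivalued lsc cover)
  then obtain \<D> where "\<D> \<subseteq> join n (pulled_cover \<phi> \<A>)" "finite \<D>" "UNIV \<subseteq> \<Union>\<D>"
    using compactE[OF compact, of "join n (pulled_cover \<phi> \<A>)"] unfolding open_cover_def by auto
  then show thesis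
    using min_subcover_attained that by blast
qed

text \<open>The space is a type, hence nonempty, and the empty family cannot cover it. This keeps
  the logarithms below meaningful.\<close>

lemma min_subcover_join_pos: "min_subcover (join n (pulled_cover \<phi> \<A>)) > 0"
proof -
  obtain \<D> where "\<D> \<subseteq> join n (pulled_cover \<phi> \<A>)" "finite \<D>" "\<Union>\<D> = UNIV"
    "card \<D> = min_subcover (join n (pulled_cover \<phi> \<A>))" by (rule join_subcover)
  then show ?thesis by (metis Union_empty card_gt_0_iff UNIV_not_empty)
qed

text \<open>Only the inclusion
  \<open>large_preimage \<psi> (\<Inter>k. A k) \<subseteq> (\<Inter>k. large_preimage \<psi> (A k))\<close> holds in general,
  but it is the one needed: the pulled-back subcover refines the cover obtained from it.\<close>

lemma min_subcover_join_add:
  "min_subcover (join (m + n) (pulled_cover \<phi> \<A>))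
    \<le> min_subcover (join m (pulled_cover \<phi> \<A>)) * min_subcover (join n (pulled_cover \<phi> \<A>))"
proof -
  let ?T = "\<lambda>k. large_preimage (miter \<phi> k)"
  let ?J = "\<lambda>n. join n (pulled_cover \<phi> \<A>)"
  obtain \<D> where \<D>: "\<D> \<subseteq> ?J m" "finite \<D>" "\<Union>\<D> = UNIV" "card \<D> = min_subcover (?J m)"
    by (rule join_subcover)
  obtain \<E> where \<E>: "\<E> \<subseteq> ?J n" "finite \<E>" "\<Union>\<E> = UNIV" "card \<E> = min_subcover (?J n)"
    by (rule join_subcover)
  \<comment> \<open>\<open>join\<close> leaves out the empty set. Requiring V to meet the preimage
    of W makes the intersection built from the pair nonempty, and dropping the other pairs uncovers
    no point.\<close>
  define I where "I = {(V, W). V \<in> \<D> \<and> W \<in> \<E> \<and> V \<inter> ?T m W \<noteq> {}}"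
  have "\<exists>Z\<in>?J (m + n). V \<inter> ?T m W \<subseteq> Z" if "(V, W) \<in> I" for V W
  proof -
    have VW: "V \<in> ?J m" "W \<in> ?J n" "V \<inter> ?T m W \<noteq> {}"
      using that \<D>(1) \<E>(1) by (auto simp: I_def)
    obtain Q where Q: "\<And>k. k < m \<Longrightarrow> Q k \<in> pulled_cover \<phi> \<A> k" "V = (\<Inter>k<m. Q k)"
      using VW(1) by (auto simp: join_def)
    obtain R where R: "\<And>k. k < n \<Longrightarrow> R k \<in> pulled_cover \<phi> \<A> k" "W = (\<Inter>k<n. R k)"
      using VW(2) by (auto simp: join_def)
    \<comment> \<open>The sets defining V fill the times below m; those defining W, pulled back by m
      further steps, fill the times from m on.\<close>
    define S where "S k = (if k < m then Q k else ?T m (R (k - m)))" for k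
    have "?T m (R (k - m)) \<in> pulled_cover \<phi> \<A> k" if "m \<le> k" "k < m + n" for k
    proof -
      have "k - m < n" using that by linarith
      then obtain A where "A \<in> \<A>" "R (k - m) = ?T (k - m) A"
        using R(1)[of "k - m"] by (auto simp: pulled_cover_def)
      then show ?thesis
        using that large_preimage_miter_add[of \<phi> m "k - m" A] by (auto simp: pulled_cover_def)
    qed
    then have "\<forall>k<m+n. S k \<in> pulled_cover \<phi> \<A> k"
      using Q(1) by (simp add: S_def)
    moreover have sub: "V \<inter> ?T m W \<subseteq> (\<Inter>k<m+n. S k)"
    proof
      fix x assume x: "x \<in> V \<inter> ?T m W"
      have "x \<in> S k" if "k < m + n" for k
      proof (cases "k < m")
        case True
        then show ?thesis using x Q(2) by (simp add: S_def)
      next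
        case False
        then have "W \<subseteq> R (k - m)" using R(2) that by auto
        then show ?thesis
          using False x large_preimage_mono[of W "R (k - m)" "miter \<phi> m"] by (auto simp: S_def)
      qed
      then show "x \<in> (\<Inter>k<m+n. S k)" by simp
    qed
    moreover have "(\<Inter>k<m+n. S k) \<noteq> {}" using sub VW(3) by blast
    ultimately have "(\<Inter>k<m+n. S k) \<in> ?J (m + n)" unfolding join_def by blast
    then show ?thesis using sub by blast
  qed
  then obtain Z where Z: "\<And>V W. (V, W) \<in> I \<Longrightarrow> Z V W \<in> ?J (m + n) \<and> V \<inter> ?T m W \<subseteq> Z V W"
    by metis
  have "I \<subseteq> \<D> \<times> \<E>" by (auto simp: I_def)
  then have fin: "finite I" "card I \<le> card \<D> * card \<E>"
    using \<D>(2) \<E>(2) card_mono[of "\<D> \<times> \<E>" I] by (auto simp: finite_subset card_cartesian_product)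
  have "x \<in> \<Union>(case_prod Z ` I)" for x
  proof -
    obtain V where V: "V \<in> \<D>" "x \<in> V" using \<D>(3) by blast
    have "x \<in> ?T m (\<Union>W\<in>\<E>. W)"
      using \<E>(3) large_preimage_miter_UNIV[OF multivalued] by simp
    then obtain W where W: "W \<in> \<E>" "x \<in> ?T m W" unfolding large_preimage_UN by blast
    have "(V, W) \<in> I" using V W by (auto simp: I_def)
    moreover from this have "x \<in> Z V W" using Z V W by blast
    ultimately show ?thesis by force
  qed
  then have "min_subcover (?J (m + n)) \<le> card (case_prod Z ` I)"
    using Z fin(1) by (intro min_subcover_le) auto
  also have "\<dots> \<le> card I" using fin(1) by (rule card_image_le)
  finally show ?thesis using fin(2) \<D>(4) \<E>(4) by simp
qed

text \<open>Submultiplicativity of the subcover numbers makes their logarithms subadditive, so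
  Fekete's lemma applies. Only with convergence known does \<open>lim\<close> in the definition
  denote a limit.\<close>

lemma tendsto_topological_entropy_of:
  "(\<lambda>n. ereal (ln (real (min_subcover (join n (pulled_cover \<phi> \<A>)))) / real n))
    \<longlonglongrightarrow> topological_entropy_of \<phi> \<A>"
proof -
  let ?N = "\<lambda>n. min_subcover (join n (pulled_cover \<phi> \<A>))"
  have "convergent (\<lambda>n. ln (real (?N n)) / real n)"
  proof (rule convergent_subadditive)
    show "0 \<le> ln (real (?N n))" for n
      using min_subcover_join_pos[of n] by simp
    fix m n
    have "ln (real (?N (m + n))) \<le> ln (real (?N m * ?N n))"
      using min_subcover_join_pos[of "m + n"] min_subcover_join_add[of m n] by (simp only: ln_mono of_nat_le_iff of_nat_0_less_iff)
    also have "\<dots> = ln (real (?N m)) + ln (real (?N n))"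
      using min_subcover_join_pos[of m] min_subcover_join_pos[of n] by (simp add: ln_mult)
    finally show "ln (real (?N (m + n))) \<le> ln (real (?N m)) + ln (real (?N n))" .
  qed
  then obtain L where "(\<lambda>n. ln (real (?N n)) / real n) \<longlonglongrightarrow> L"
    by (auto simp: convergent_def)
  then have lim: "(\<lambda>n. ereal (ln (real (?N n)) / real n)) \<longlonglongrightarrow> ereal L" by simp
  show ?thesis
    using lim unfolding topological_entropy_of_def limI[OF lim] .
qed

end

section \<open>Entropy of the joined partition against the size of a subcover\<close>

context measure_preserving_multimap
begin

lemma borel_in_completion: "A \<in> sets borel \<Longrightarrow> A \<in> sets \<nu>"
  using sets_eq_borel by auto

text \<open>Coding by the subcover costs \<open>ln (real (card \<D>))\<close>. Each time step adds
  at most \<open>- ln (1 - \<epsilon>)\<close>, and \<open>ln (real r / \<epsilon>)\<close> more on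
  the bad set of that time, whose measure is the same at all times because iterated preimages
  preserve \<open>\<nu>\<close>.\<close>

lemma partition_entropy_join_le:
  fixes Ps :: "'a set list" and C :: "nat \<Rightarrow> 'a set"
  defines "r \<equiv> length Ps"
  defines "U \<equiv> \<lambda>i. - (\<Union>l\<in>{..<r} - {i}. C l)"
  assumes multivalued: "multivalued \<phi>"
    and Ps: "ordered_partition \<mu> Ps"
    and C: "\<And>i. i < r \<Longrightarrow> C i \<in> sets borel" "\<And>i. i < r \<Longrightarrow> C i \<subseteq> Ps ! i"
    and \<D>: "\<D> \<subseteq> join n (pulled_cover \<phi> (U ` {..<r}))" "finite \<D>" "\<Union>\<D> = UNIV"
    and \<epsilon>: "0 < \<epsilon>" "\<epsilon> < 1"
  shows "partition_entropy \<mu> (join n (pulled_partition \<phi> Ps)) \<le> ln (real (card \<D>)) +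
    real n * (ln (real r / \<epsilon>) * measure \<mu> (\<Union>i<r. Ps ! i - C i) - ln (1 - \<epsilon>))"
proof -
  define T where "T k = large_preimage (miter \<phi> k)" for k
  \<comment> \<open>Preimages of disjoint sets may overlap; \<open>E k j\<close> holds the points
    for which j is the least index available at time k.\<close>
  define E where "E k j = T k (Ps ! j) - (\<Union>i<j. T k (Ps ! i))" for k j
  define bad where "bad k = T k (\<Union>i<r. Ps ! i - C i)" for k
  define \<W> where "\<W> = join n (pulled_partition \<phi> Ps)"
  define words where "words = PiE {..<n} (\<lambda>_. {..<r})"
  have Ps_borel: "Ps ! i \<in> sets borel" if "i < r" for i
    using Ps that sets_eq_borel unfolding ordered_partition_def r_def by auto
  have T_sets: "T k A \<in> sets \<nu>" if "A \<in> sets borel" for k A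
    unfolding T_def using that by (intro sets_preimage_miter borel_in_completion)
  have U_borel: "U i \<in> sets borel" for i
    unfolding U_def using C(1) by (intro borel_comp sets.finite_UN) auto
  have Ps_bad_borel: "(\<Union>i<r. Ps ! i - C i) \<in> sets borel"
    using C(1) Ps_borel by auto
  \<comment> \<open>With no members the union would have measure 0 instead of 1.\<close>
  have r_pos: "r > 0"
    using Ps prob_space by (auto simp: ordered_partition_def r_def)
  have finite_words: "finite words"
    unfolding words_def by (intro finite_PiE) auto

  have pulled: "pulled_partition \<phi> Ps k = E k ` {..<r}" for k
    using Ps unfolding E_def T_def r_def ordered_partition_def by (simp add: pulled_partition_eq)
  have word_of: "\<exists>a. a \<in> words \<and> W = (\<Inter>k<n. E k (a k))" if W: "W \<in> \<W>" for W
  proof -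
    obtain Q where Q: "\<And>k. k < n \<Longrightarrow> Q k \<in> E k ` {..<r}" "W = (\<Inter>k<n. Q k)"
      using W unfolding \<W>_def join_def pulled by blast
    then have "\<forall>k. \<exists>j. k < n \<longrightarrow> j < r \<and> Q k = E k j" by blast
    then obtain a where "\<And>k. k < n \<Longrightarrow> a k < r \<and> Q k = E k (a k)" by metis
    then show ?thesis
      using Q(2) by (intro exI[of _ "restrict a {..<n}"]) (auto simp: words_def)
  qed
  then obtain a where a: "\<And>W. W \<in> \<W> \<Longrightarrow> a W \<in> words"
    and W_eq: "\<And>W. W \<in> \<W> \<Longrightarrow> W = (\<Inter>k<n. E k (a W k))" by metis
  have inj_a: "inj_on a \<W>"
  proof (rule inj_onI)
    fix V W assume "V \<in> \<W>" "W \<in> \<W>" "a V = a W"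
    then show "V = W" using W_eq[of V] W_eq[of W] by simp
  qed
  have "finite \<W>" using a inj_a finite_words by (meson finite_imageD finite_subset image_subsetI)
  have a_less: "a W k < r" if "W \<in> \<W>" "k < n" for W k
    using a[OF that(1)] that(2) by (auto simp: words_def)
  have W_sub: "W \<subseteq> E k (a W k)" if "W \<in> \<W>" "k < n" for W k
    using W_eq[OF that(1)] that(2) by blast
  have E_disj: "E k i \<inter> E k j = {}" if "i \<noteq> j" for k i j
    using that by (cases "i < j") (auto simp: E_def)
  have \<W>_disj: "disjoint_family_on (\<lambda>W. W) \<W>"
  proof (unfold disjoint_family_on_def, intro ballI impI)
    fix V W assume VW: "V \<in> \<W>" "W \<in> \<W>" "V \<noteq> W"
    then have "a V \<noteq> a W" using inj_a by (auto dest: inj_onD)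
    then obtain k where k: "k < n" "a V k \<noteq> a W k"
      using a VW unfolding words_def by (metis PiE_ext lessThan_iff)
    show "V \<inter> W = {}"
      using E_disj[OF k(2), of k] W_sub[OF VW(1) k(1)] W_sub[OF VW(2) k(1)] by blast
  qed
  have E_sets: "E k j \<in> sets \<nu>" if "j < r" for k j
    unfolding E_def using that Ps_borel T_sets by auto
  have \<W>_sets: "W \<in> sets \<nu>" if "W \<in> \<W>" for W
  \<comment> \<open>For n = 0 the intersection is empty and equals the whole space, while
    \<open>sets.finite_INT\<close> requires a nonempty index set.\<close>
  proof (cases "n = 0")
    case True
    then show ?thesis using W_eq[OF that] sets.top[of \<nu>] by simp
  next
    case False
    then have "(\<Inter>k<n. E k (a W k)) \<in> sets \<nu>"
      using that by (intro sets.finite_INT E_sets a_less) auto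
    then show ?thesis using W_eq[OF that] by simp
  qed

  have "\<exists>i. i \<in> words \<and> D = (\<Inter>k<n. T k (U (i k)))" if D: "D \<in> \<D>" for D
  proof -
    obtain Q where Q: "\<And>k. k < n \<Longrightarrow> Q k \<in> T k ` U ` {..<r}" "D = (\<Inter>k<n. Q k)"
      using D \<D>(1) unfolding join_def pulled_cover_def T_def by blast
    then have "\<forall>k. \<exists>j. k < n \<longrightarrow> j < r \<and> Q k = T k (U j)" by blast
    then obtain i where "\<And>k. k < n \<Longrightarrow> i k < r \<and> Q k = T k (U (i k))" by metis
    then show ?thesis
      using Q(2) by (intro exI[of _ "restrict i {..<n}"]) (auto simp: words_def)
  qed
  then obtain c where c: "\<And>D. D \<in> \<D> \<Longrightarrow> c D \<in> words"
    and D_eq: "\<And>D. D \<in> \<D> \<Longrightarrow> D = (\<Inter>k<n. T k (U (c D k)))" by metis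
  have c_less: "c D k < r" if "D \<in> \<D>" "k < n" for D k
    using c[OF that(1)] that(2) by (auto simp: words_def)
  have card_pos: "card \<D> > 0"
    using \<D> by (metis Union_empty card_gt_0_iff UNIV_not_empty)

  \<comment> \<open>A mixture of the point mass at i and the uniform vector on r letters. The
    uniform share keeps every weight positive, as Gibbs' inequality requires of q.\<close>
  define w where "w j i = (if j = i then 1 - \<epsilon> else 0) + \<epsilon> / real r" for j i :: nat
  have w_pos: "w j i > 0" for j i
    unfolding w_def using \<epsilon> r_pos by (auto intro: add_nonneg_pos)
  have w_sum: "(\<Sum>j<r. w j i) = 1" if "i < r" for i
    unfolding w_def using that r_pos by (simp add: sum.distrib)
  define q where "q b = (\<Sum>D\<in>\<D>. \<Prod>k<n. w (b k) (c D k)) / real (card \<D>)" for b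
  have prod_pos: "(\<Prod>k<n. w (b k) (c D k)) > 0" for b D
    using w_pos by (intro prod_pos) auto
  have q_pos: "q b > 0" for b
    unfolding q_def using card_pos prod_pos \<D>(2)
    by (intro divide_pos_pos sum_pos) (auto simp: card_gt_0_iff)
  have "(\<Sum>b\<in>words. q b) = (\<Sum>D\<in>\<D>. \<Sum>b\<in>words. \<Prod>k<n. w (b k) (c D k)) / real (card \<D>)"
    unfolding q_def sum_divide_distrib[symmetric] by (subst sum.swap) simp
  also have "(\<Sum>D\<in>\<D>. \<Sum>b\<in>words. \<Prod>k<n. w (b k) (c D k)) = (\<Sum>D\<in>\<D>. 1)"
  proof (intro sum.cong refl)
    fix D assume D: "D \<in> \<D>"
    have "(\<Sum>b\<in>words. \<Prod>k<n. w (b k) (c D k)) = (\<Prod>k<n. \<Sum>j<r. w j (c D k))"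
      unfolding words_def by (rule prod_sum_PiE[symmetric]) auto
    also have "\<dots> = 1" using w_sum c_less[OF D] by simp
    finally show "(\<Sum>b\<in>words. \<Prod>k<n. w (b k) (c D k)) = 1" .
  qed
  finally have q_sum: "(\<Sum>b\<in>words. q b) = 1" using card_pos by simp
  \<comment> \<open>Some words give an empty intersection and code no member of the join, so only an
    inequality is available.\<close>
  have "(\<Sum>W\<in>\<W>. q (a W)) = (\<Sum>b\<in>a ` \<W>. q b)"
    using inj_a by (simp add: sum.reindex)
  also have "\<dots> \<le> (\<Sum>b\<in>words. q b)"
    using a finite_words q_pos by (intro sum_mono2) (auto intro: less_imp_le)
  finally have q_le: "(\<Sum>W\<in>\<W>. q (a W)) \<le> 1" using q_sum by simp

  \<comment> \<open>The partition covers the space only up to a null set; preservation of measure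
    passes this on to every time k.\<close>
  have AE_cover: "AE x in \<nu>. \<forall>k<n. x \<in> T k (\<Union>(set Ps))"
  proof -
    have "\<Union>(set Ps) \<in> sets borel"
      using Ps sets_eq_borel unfolding ordered_partition_def by (intro sets.finite_Union) auto
    then have "AE x in \<nu>. x \<in> T k (\<Union>(set Ps))" for k
      using T_sets[of _ k] Ps prob_space measure_preimage_miter[of "\<Union>(set Ps)" k] sets_eq_borel
      by (intro compl.AE_prob_1) (simp add: T_def ordered_partition_def)
    then show ?thesis by (simp add: AE_all_countable)
  qed
  \<comment> \<open>\<open>U i\<close> and \<open>C l\<close> are disjoint, yet a multivalued image
    may meet both. The condition on intersections makes the overlap of their preimages null.\<close>
  have AE_code: "AE x in \<nu>. \<forall>k<n. \<forall>i<r. \<forall>l<r. l \<noteq> i \<longrightarrow> \<not> (x \<in> T k (U i) \<and> x \<in> T k (C l))"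
  proof -
    have "AE x in \<nu>. l \<noteq> i \<longrightarrow> \<not> (x \<in> T k (U i) \<and> x \<in> T k (C l))" if "l < r" for k i l
    proof (cases "l = i")
      case False
      have "U i \<inter> C l = {}" using False that by (auto simp: U_def)
      then have "measure \<nu> (T k (U i) \<inter> T k (C l)) = 0"
        using measure_preimage_miter_Int[of "U i" "C l" k] U_borel C(1)[OF that]
        by (simp add: T_def borel_in_completion)
      then have "T k (U i) \<inter> T k (C l) \<in> null_sets \<nu>"
        using T_sets[OF U_borel] T_sets[OF C(1)[OF that]]
        by (intro null_setsI) (auto simp: compl.emeasure_eq_measure)
      from AE_not_in[OF this] show ?thesis by eventually_elim auto
    qed simp
    then show ?thesis by (simp add: AE_all_countable)
  qed
  have AE_\<W>: "AE x in \<nu>. x \<in> \<Union>\<W>"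
    using AE_cover
  proof eventually_elim
    case (elim x)
    \<comment> \<open>The least suitable index at each time selects a member containing x; the
      intersection of these members is nonempty and so belongs to the join.\<close>
    have "\<exists>j<r. x \<in> E k j" if "k < n" for k
    proof -
      have "\<exists>j. j < r \<and> x \<in> T k (Ps ! j)"
        using elim that unfolding T_def r_def large_preimage_def by (fastforce simp: in_set_conv_nth)
      then obtain j where j: "j < r" "x \<in> T k (Ps ! j)" "\<And>i. i < j \<Longrightarrow> \<not> (i < r \<and> x \<in> T k (Ps ! i))"
        using exists_least_iff[of "\<lambda>j. j < r \<and> x \<in> T k (Ps ! j)"] by blast
      then have "x \<notin> T k (Ps ! i)" if "i < j" for i using that less_trans by blast
      then show ?thesis unfolding E_def using j(1,2) by blast
    qed
    then obtain j where j: "\<And>k. k < n \<Longrightarrow> j k < r \<and> x \<in> E k (j k)" by metis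
    then have x: "x \<in> (\<Inter>k<n. E k (j k))" by simp
    have "(\<Inter>k<n. E k (j k)) \<in> \<W>"
      unfolding \<W>_def join_def pulled using j x
      by (intro CollectI conjI exI[of _ "\<lambda>k. E k (j k)"]) auto
    with x show ?case by (rule UnionI[rotated])
  qed
  have "(\<Sum>W\<in>\<W>. measure \<nu> W) = measure \<nu> (\<Union>\<W>)"
    using compl.finite_measure_finite_Union[OF \<open>finite \<W>\<close> _ \<W>_disj] \<W>_sets by (simp add: subsetI)
  also have "\<dots> = 1"
    using AE_\<W> \<open>finite \<W>\<close> \<W>_sets by (subst compl.prob_eq_1) (auto intro: sets.finite_Union)
  finally have p_sum: "(\<Sum>W\<in>\<W>. measure \<nu> W) = 1" .

  define L where "L = ln (real r / \<epsilon>)"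
  have L_nonneg: "L \<ge> 0" unfolding L_def using \<epsilon> r_pos by simp
  \<comment> \<open>A bound for \<open>- ln (q (a W))\<close> on W that mentions neither W nor an
    element of the subcover; its integral is the claimed right-hand side.\<close>
  define g where "g x = ln (real (card \<D>)) + (\<Sum>k<n. L * indicator (bad k) x - ln (1 - \<epsilon>))" for x
  have ln_nonpos: "ln (1 - \<epsilon>) \<le> 0" using \<epsilon> by simp
  have g_nonneg: "g x \<ge> 0" for x
    unfolding g_def using card_pos L_nonneg ln_nonpos
    by (intro add_nonneg_nonneg sum_nonneg) (auto simp: indicator_def)
  have bound: "AE x in \<nu>. \<forall>W\<in>\<W>. x \<in> W \<longrightarrow> - ln (q (a W)) \<le> g x"
    using AE_code
  proof (eventually_elim, intro ballI impI)
    fix x W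
    assume code: "\<forall>k<n. \<forall>i<r. \<forall>l<r. l \<noteq> i \<longrightarrow> \<not> (x \<in> T k (U i) \<and> x \<in> T k (C l))"
      and W: "W \<in> \<W>" "x \<in> W"
    obtain D where D: "D \<in> \<D>" "x \<in> D" using \<D>(3) by blast
    have factor: "- ln (w (a W k) (c D k)) \<le> L * indicator (bad k) x - ln (1 - \<epsilon>)" if k: "k < n" for k
    proof (cases "x \<in> bad k")
      case True
      have "\<epsilon> / real r \<le> w (a W k) (c D k)" unfolding w_def using \<epsilon> by simp
      then have "ln (\<epsilon> / real r) \<le> ln (w (a W k) (c D k))"
        using \<epsilon> r_pos by (intro ln_mono) auto
      moreover have "ln (\<epsilon> / real r) = - L" unfolding L_def using \<epsilon> r_pos by (simp add: ln_div)
      ultimately show ?thesis using True ln_nonpos by simp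
    next
      case False
      \<comment> \<open>Off the bad set, the image of x at time k meets \<open>Ps ! a W k\<close>
        only inside \<open>C (a W k)\<close>. As x also lies in the preimage of
        \<open>U (c D k)\<close>, the excluded overlaps force the predicted letter to be the true
        one.\<close>
      have "x \<in> T k (Ps ! a W k)" using W_sub[OF W(1) k] W(2) by (auto simp: E_def)
      then have "x \<in> T k (C (a W k))"
        using False a_less[OF W(1) k] unfolding bad_def T_def large_preimage_def by blast
      moreover have "x \<in> T k (U (c D k))" using D_eq[OF D(1)] D(2) k by blast
      ultimately have "a W k = c D k"
        using code k a_less[OF W(1) k] c_less[OF D(1) k] by blast
      then have "1 - \<epsilon> \<le> w (a W k) (c D k)" unfolding w_def using \<epsilon> by simp
      then have "ln (1 - \<epsilon>) \<le> ln (w (a W k) (c D k))" using \<epsilon> by (intro ln_mono) auto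
      then show ?thesis using False by simp
    qed
    \<comment> \<open>Keeping only the term of D in the average defining q loses at most a factor
      \<open>card \<D>\<close>.\<close>
    have "(\<Prod>k<n. w (a W k) (c D k)) / real (card \<D>) \<le> q (a W)"
      unfolding q_def using D(1) \<D>(2) prod_pos
      by (intro divide_right_mono member_le_sum) (auto intro: less_imp_le)
    then have "ln ((\<Prod>k<n. w (a W k) (c D k)) / real (card \<D>)) \<le> ln (q (a W))"
      using prod_pos[of "a W" D] card_pos by (intro ln_mono) auto
    moreover have "ln ((\<Prod>k<n. w (a W k) (c D k)) / real (card \<D>))
        = (\<Sum>k<n. ln (w (a W k) (c D k))) - ln (real (card \<D>))"
    proof -
      have "ln (\<Prod>k<n. w (a W k) (c D k)) = (\<Sum>k<n. ln (w (a W k) (c D k)))"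
        using w_pos by (intro ln_prod) (auto simp: less_imp_neq[symmetric])
      moreover have "(\<Prod>k<n. w (a W k) (c D k)) \<noteq> 0" using prod_pos[of "a W" D] by (rule less_imp_neq[symmetric])
      ultimately show ?thesis using card_pos by (simp only: ln_div of_nat_eq_0_iff) simp
    qed
    moreover have "(\<Sum>k<n. - ln (w (a W k) (c D k))) \<le> (\<Sum>k<n. L * indicator (bad k) x - ln (1 - \<epsilon>))"
      using factor by (intro sum_mono) auto
    ultimately show "- ln (q (a W)) \<le> g x" unfolding g_def by (simp add: sum_negf)
  qed

  have bad_sets: "bad k \<in> sets \<nu>" for k unfolding bad_def by (intro T_sets Ps_bad_borel)
  have measure_bad: "measure \<nu> (bad k) = measure \<mu> (\<Union>i<r. Ps ! i - C i)" for k
    unfolding bad_def T_def using Ps_bad_borel sets_eq_borel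
    by (simp add: measure_preimage_miter borel_in_completion)
  have int_indicator: "integrable \<nu> (indicator A :: 'a \<Rightarrow> real)" if "A \<in> sets \<nu>" for A
    using that by (intro integrable_real_indicator) (auto simp: compl.emeasure_eq_measure)
  have "partition_entropy \<mu> \<W> \<le> - (\<Sum>W\<in>\<W>. measure \<nu> W * ln (q (a W)))"
    unfolding partition_entropy_def using q_pos q_le p_sum by (intro gibbs_inequality) auto
  \<comment> \<open>As an integral, the sum can be bounded pointwise, each x using its own element
    of the subcover.\<close>
  also have "\<dots> = (\<integral>x. (\<Sum>W\<in>\<W>. indicator W x * - ln (q (a W))) \<partial>\<nu>)"
    using \<W>_sets int_indicator by (subst Bochner_Integration.integral_sum) (auto simp: sum_negf)
  also have "\<dots> \<le> (\<integral>x. g x \<partial>\<nu>)"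
  proof (rule integral_mono_AE)
    show "AE x in \<nu>. (\<Sum>W\<in>\<W>. indicator W x * - ln (q (a W))) \<le> g x"
      using bound
    proof eventually_elim
      case (elim x)
      show ?case
      proof (cases "x \<in> \<Union>\<W>")
        case True
        then obtain V where V: "V \<in> \<W>" "x \<in> V" by blast
        then have "indicator W x = (if W = V then 1 else 0 :: real)" if "W \<in> \<W>" for W
          using disjoint_family_onD[OF \<W>_disj that V(1)] V(2) by (cases "W = V") (auto simp: indicator_def)
        then have "(\<Sum>W\<in>\<W>. indicator W x * - ln (q (a W))) = (\<Sum>W\<in>\<W>. if W = V then - ln (q (a W)) else 0)"
          by (intro sum.cong) auto
        also have "\<dots> = - ln (q (a V))" using V \<open>finite \<W>\<close> by simp
        finally show ?thesis using elim V by simp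
      next
        \<comment> \<open>Outside all members the integrand vanishes, which is why nonnegativity of
          \<open>g\<close> was recorded.\<close>
        case False
        then have "(\<Sum>W\<in>\<W>. indicator W x * - ln (q (a W))) = 0" by (intro sum.neutral) auto
        then show ?thesis using g_nonneg[of x] by simp
      qed
    qed
  qed (use \<W>_sets bad_sets int_indicator in \<open>auto simp: g_def\<close>)
  also have "\<dots> = ln (real (card \<D>)) + (\<Sum>k<n. L * measure \<nu> (bad k) - ln (1 - \<epsilon>))"
    unfolding g_def using bad_sets int_indicator compl.prob_space by (simp add: Bochner_Integration.integral_sum)
  also have "\<dots> = ln (real (card \<D>)) + real n * (L * measure \<mu> (\<Union>i<r. Ps ! i - C i) - ln (1 - \<epsilon>))"
    by (simp add: measure_bad)
  finally show ?thesis by (simp add: \<W>_def L_def)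
qed

section \<open>Choice of the cover and passage to the limit\<close>

text \<open>One cover has to serve all n so that its entropy appears in the limit. Hence \<epsilon>
  is fixed from \<delta>, the closed sets from \<epsilon>, and only then does n vary.\<close>

lemma partition_entropy_le_topological:
  fixes Ps :: "'a set list"
  assumes compact: "compact (UNIV :: 'a set)" and multivalued: "multivalued \<phi>" and lsc: "lsc \<phi>"
    and Ps: "ordered_partition \<mu> Ps" and "0 < \<delta>"
  obtains \<A> where "open_cover \<A>"
    "\<And>n. partition_entropy \<mu> (join n (pulled_partition \<phi> Ps))
      \<le> ln (real (min_subcover (join n (pulled_cover \<phi> \<A>)))) + real n * \<delta>"
proof -
  define r where "r = length Ps"
  have Ps_borel: "Ps ! i \<in> sets borel" if "i < r" for i
    using Ps that sets_eq_borel unfolding ordered_partition_def r_def by auto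
  have r_pos: "r > 0"
    using Ps prob_space by (auto simp: ordered_partition_def r_def)
  \<comment> \<open>Solves \<open>- ln (1 - \<epsilon>) = \<delta> / 2\<close>; the other half of
    \<delta> is left for the bad set.\<close>
  define \<epsilon> where "\<epsilon> = 1 - exp (- \<delta> / 2)"
  have \<epsilon>: "0 < \<epsilon>" "\<epsilon> < 1" and ln_\<epsilon>: "ln (1 - \<epsilon>) = - \<delta> / 2"
    using \<open>0 < \<delta>\<close> by (simp_all add: \<epsilon>_def)
  define L where "L = ln (real r / \<epsilon>)"
  have L_nonneg: "L \<ge> 0" unfolding L_def using \<epsilon> r_pos by simp
  \<comment> \<open>Makes r exceptional sets of measure below \<open>e\<close>, weighted by
    \<open>L\<close>, cost at most \<open>\<delta> / 2\<close>. The denominator has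
    \<open>L + 1\<close> because only \<open>L \<ge> 0\<close> is established.\<close>
  define e where "e = \<delta> / (2 * real r * (L + 1))"
  have "e > 0" unfolding e_def using \<open>0 < \<delta>\<close> r_pos L_nonneg by simp
  have "\<exists>C. closed C \<and> C \<subseteq> Ps ! i \<and> measure \<mu> (Ps ! i - C) < e" if "i < r" for i
  proof -
    note Ps_i_borel = Ps_borel[OF that]
    obtain F V where FV: "closed F" "open V" "F \<subseteq> Ps ! i" "Ps ! i \<subseteq> V" "measure \<mu> (V - F) < e"
      using closed_open_approximation[OF finite_measure_axioms sets_eq_borel Ps_i_borel \<open>e > 0\<close>]
      by blast
    have "measure \<mu> (Ps ! i - F) \<le> measure \<mu> (V - F)"
      using FV(1,2,4) sets_eq_borel by (intro finite_measure_mono) auto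
    then show ?thesis using FV(1,3,5) by (intro exI[of _ F]) simp
  qed
  then obtain C where C: "\<And>i. i < r \<Longrightarrow> closed (C i)" "\<And>i. i < r \<Longrightarrow> C i \<subseteq> Ps ! i"
    "\<And>i. i < r \<Longrightarrow> measure \<mu> (Ps ! i - C i) < e" by metis
  define U where "U i = - (\<Union>l\<in>{..<r} - {i}. C l)" for i
  define \<A> where "\<A> = U ` {..<r}"
  have C_disj: "C i \<inter> C l = {}" if "i < r" "l < r" "i \<noteq> l" for i l
  proof -
    have "Ps ! i \<inter> Ps ! l = {}"
      using Ps that unfolding ordered_partition_def r_def
      by (intro disjointD[of "set Ps"]) (auto simp: nth_eq_iff_index_eq)
    then show ?thesis using C(2)[OF that(1)] C(2)[OF that(2)] by blast
  qed
  have cover: "open_cover \<A>"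
    unfolding open_cover_def
  proof (intro conjI ballI equalityI subset_UNIV subsetI)
    fix A assume "A \<in> \<A>"
    then show "open A"
      unfolding \<A>_def U_def using C(1) by (auto intro!: open_Compl closed_UN)
  next
    fix x
    show "x \<in> \<Union>\<A>"
    \<comment> \<open>A point of \<open>C i\<close> lies in no other \<open>C l\<close>, hence in
      \<open>U i\<close>; a point in none of them lies in every \<open>U i\<close>, in particular in
      \<open>U 0\<close>.\<close>
    proof (cases "\<exists>i<r. x \<in> C i")
      case True
      then obtain i where "i < r" "x \<in> C i" by blast
      then have "x \<in> U i" using C_disj unfolding U_def by blast
      then show ?thesis using \<open>i < r\<close> unfolding \<A>_def by blast
    next
      case False
      then have "x \<in> U 0" unfolding U_def by blast
      then show ?thesis using r_pos unfolding \<A>_def by blast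
    qed
  qed
  have C_borel: "C i \<in> sets borel" if "i < r" for i using C(1)[OF that] by simp
  have "measure \<mu> (\<Union>i<r. Ps ! i - C i) \<le> (\<Sum>i<r. measure \<mu> (Ps ! i - C i))"
    using Ps_borel C_borel sets_eq_borel by (intro finite_measure_subadditive_finite) auto
  also have "\<dots> \<le> (\<Sum>i<r. e)"
    using C(3) by (intro sum_mono) (auto intro: less_imp_le)
  finally have "L * measure \<mu> (\<Union>i<r. Ps ! i - C i) \<le> L * (real r * e)"
    using L_nonneg by (intro mult_left_mono) auto
  also have "\<dots> \<le> (L + 1) * (real r * e)"
    using \<open>e > 0\<close> by (intro mult_right_mono) auto
  also have "\<dots> = \<delta> / 2"
    unfolding e_def using r_pos L_nonneg by (simp add: field_simps add_nonneg_eq_0_iff)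
  finally have small: "L * measure \<mu> (\<Union>i<r. Ps ! i - C i) - ln (1 - \<epsilon>) \<le> \<delta>"
    by (simp add: ln_\<epsilon>)
  have "partition_entropy \<mu> (join n (pulled_partition \<phi> Ps))
      \<le> ln (real (min_subcover (join n (pulled_cover \<phi> \<A>)))) + real n * \<delta>" for n
  proof -
    obtain \<D> where \<D>: "\<D> \<subseteq> join n (pulled_cover \<phi> \<A>)" "finite \<D>" "\<Union>\<D> = UNIV"
      "card \<D> = min_subcover (join n (pulled_cover \<phi> \<A>))"
      using join_subcover[OF compact multivalued lsc cover] .
    have "partition_entropy \<mu> (join n (pulled_partition \<phi> Ps)) \<le> ln (real (card \<D>)) +
        real n * (L * measure \<mu> (\<Union>i<r. Ps ! i - C i) - ln (1 - \<epsilon>))"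
      unfolding L_def r_def
      by (rule partition_entropy_join_le[OF multivalued Ps _ _ _ \<D>(2,3) \<epsilon>])
        (use C_borel C(2) \<D>(1) in \<open>auto simp: r_def \<A>_def U_def\<close>)
    also have "\<dots> \<le> ln (real (card \<D>)) + real n * \<delta>"
      using small by (intro add_left_mono mult_left_mono) auto
    finally show ?thesis using \<D>(4) by simp
  qed
  with cover show thesis by (rule that)
qed

text \<open>Dividing the uniform estimate by n and taking the upper limit leaves an error \<delta>,
  which is arbitrary.\<close>

lemma metric_entropy_of_le_topological:
  assumes compact: "compact (UNIV :: 'a set)" and multivalued: "multivalued \<phi>" and lsc: "lsc \<phi>"
    and Ps: "ordered_partition \<mu> Ps"
  shows "metric_entropy_of \<mu> \<phi> Ps \<le> topological_entropy \<phi>"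
proof (rule ereal_le_epsilon2)
  fix \<delta> :: real assume "0 < \<delta>"
  then obtain \<A> where cover: "open_cover \<A>" and le:
    "\<And>n. partition_entropy \<mu> (join n (pulled_partition \<phi> Ps))
      \<le> ln (real (min_subcover (join n (pulled_cover \<phi> \<A>)))) + real n * \<delta>"
    using partition_entropy_le_topological[OF compact multivalued lsc Ps] by blast
  let ?t = "\<lambda>n. ereal (ln (real (min_subcover (join n (pulled_cover \<phi> \<A>)))) / real n)"
  have "metric_entropy_of \<mu> \<phi> Ps \<le> limsup (\<lambda>n. ?t n + ereal \<delta>)"
    unfolding metric_entropy_of_def
  proof (intro Limsup_mono eventually_sequentiallyI[of 1])
    fix n :: nat assume "n \<ge> 1"
    then show "ereal (partition_entropy \<mu> (join n (pulled_partition \<phi> Ps)) / real n) \<le> ?t n + ereal \<delta>"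
      using le[of n] by (simp add: field_simps)
  qed
  also have "(\<lambda>n. ?t n + ereal \<delta>) \<longlonglongrightarrow> topological_entropy_of \<phi> \<A> + ereal \<delta>"
    by (intro tendsto_add_ereal_general tendsto_topological_entropy_of[OF compact multivalued lsc cover]
        tendsto_const) auto
  then have "limsup (\<lambda>n. ?t n + ereal \<delta>) = topological_entropy_of \<phi> \<A> + ereal \<delta>"
    by (rule lim_imp_Limsup[OF trivial_limit_sequentially])
  also have "topological_entropy_of \<phi> \<A> \<le> topological_entropy \<phi>"
    unfolding topological_entropy_def using cover by (intro SUP_upper) simp
  finally show "metric_entropy_of \<mu> \<phi> Ps \<le> topological_entropy \<phi> + ereal \<delta>"
    by (simp add: add_right_mono)
qed

end

theorem theorem2:
  fixes \<phi> :: "'a::metric_space \<Rightarrow> 'a set" and \<mu> :: "'a measure"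
  assumes "compact (UNIV :: 'a set)"
    and "multivalued \<phi>"
    and "lsc \<phi>"
    and "\<mu> \<in> invariant_measures \<phi>"
    and "\<And>A. A \<in> sets borel \<Longrightarrow>
           measure (completion \<mu>) (large_preimage \<phi> A) = measure \<mu> A"
    and "\<And>A B. A \<in> sets borel \<Longrightarrow> B \<in> sets borel \<Longrightarrow>
           measure (completion \<mu>) (large_preimage \<phi> A \<inter> large_preimage \<phi> B) =
           measure (completion \<mu>) (large_preimage \<phi> (A \<inter> B))"
  shows "metric_entropy \<mu> \<phi> \<le> topological_entropy \<phi>"
proof -
  \<comment> \<open>Membership in \<open>invariant_measures\<close> supplies the probability space,
    the Borel \<sigma>-algebra and measurability of preimages; the two equations are the remaining
    hypotheses.\<close>
  interpret measure_preserving_multimap \<mu> \<phi>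
    using assms(4-6)
    by (auto simp: invariant_measures_def measure_preserving_multimap_def
        measure_preserving_multimap_axioms_def)
  show ?thesis
    unfolding metric_entropy_def
    using metric_entropy_of_le_topological[OF assms(1-3)] by (intro SUP_least) auto
qed

end
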